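(* Let $A\in\mathbb{R}^{n\times n}$ be nonsingular and let $c^*,d^*\in\mathbb{R}^n_{++}$ be a global optimal solution pair of $$\min_{c,d\in\mathbb{R}^n_{++}}\ \omega\Big(\big(\operatorname{Diag}(c)^{1/2}A\operatorname{Diag}(d)^{1/2}\big)^T\big(\operatorname{Diag}(c)^{1/2}A\operatorname{Diag}(d)^{1/2}\big)\Big).$$ Let $C^*=\operatorname{Diag}(c^* )$, $D^*=\operatorname{Diag}(d^* )$, and let $e_{2n}\in\mathbb{R}^{2n}$ be the all-ones vector. Then $$\begin{pmatrix}\operatorname{diag}(C^*AD^*A^T)\\ \operatorname{diag}(D^*A^TC^*A)\end{pmatrix}=\alpha e_{2n}\quad\text{for some }\alpha>0.$$ Hence the (Euclidean) norms of all rows and of all columns of $\sqrt{C^*}A\sqrt{D^*}$ are equal to the same constant.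
   Context: For a symmetric positive definite $n\times n$ matrix $S$, $\omega(S)=\dfrac{\operatorname{trace}(S)/n}{\det(S)^{1/n}}$. $\operatorname{diag}(S)$ is the vector of diagonal entries of $S$, $\operatorname{Diag}(c)$ the diagonal matrix with diagonal $c$, and $\mathbb{R}^n_{++}$ the set of vectors with strictly positive entries. *)

theory Defs
  imports "HOL-Analysis.Analysis"
begin

text \<open>Intended for symmetric positive definite \<open>S\<close>, where the determinant is positive.\<close>

definition omega_cond :: "real^'n^'n \<Rightarrow> real" where
  "omega_cond S = (trace S / real CARD('n)) / (det S powr (1 / real CARD('n)))"

definition diag_of :: "real^'n^'n \<Rightarrow> real^'n" where
  "diag_of S = (\<chi> i. S $ i $ i)"

definition Diag :: "real^'n \<Rightarrow> real^'n^'n" where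
  "Diag c = (\<chi> i j. if i = j then c $ i else 0)"

definition pos_vecs :: "(real^'n) set" where
  "pos_vecs = {c. \<forall>i. 0 < c $ i}"

definition stack_vec :: "real^'m \<Rightarrow> real^'n \<Rightarrow> real^('m + 'n)" where
  "stack_vec u v = (\<chi> k. case k of Inl i \<Rightarrow> u $ i | Inr j \<Rightarrow> v $ j)"

definition is_psd_sqrt :: "real^'n^'n \<Rightarrow> real^'n^'n \<Rightarrow> bool" where
  "is_psd_sqrt S R \<longleftrightarrow> transpose R = R \<and> (\<forall>x. 0 \<le> x \<bullet> (R *v x)) \<and> R ** R = S"

text \<open>The principal square root. On the matrices that matter here, it is obtained by taking the
  square roots of the diagonal entries; see \<open>psd_sqrt_Diag\<close> below.\<close>

definition psd_sqrt :: "real^'n^'n \<Rightarrow> real^'n^'n" where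
  "psd_sqrt S = (THE R. is_psd_sqrt S R)"

definition scaled :: "real^'n^'n \<Rightarrow> real^'n \<Rightarrow> real^'n \<Rightarrow> real^'n^'n" where
  "scaled A c d = psd_sqrt (Diag c) ** A ** psd_sqrt (Diag d)"

lemma Diag_nth: "Diag c $ i $ j = (if i = j then c $ i else 0)"
  by (simp add: Diag_def)

lemma Diag_mult_left: "(Diag c ** M) $ i $ j = c $ i * M $ i $ j"
  by (simp add: matrix_matrix_mult_def Diag_nth if_distrib [of "\<lambda>x. x * _"] cong: if_cong)

lemma Diag_mult_right: "(M ** Diag c) $ i $ j = M $ i $ j * c $ j"
  by (simp add: matrix_matrix_mult_def Diag_nth if_distrib [of "\<lambda>x. _ * x"] cong: if_cong)

lemma Diag_mult_vec: "(Diag c *v x) $ i = c $ i * x $ i"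
  by (simp add: matrix_vector_mult_def Diag_nth if_distrib [of "\<lambda>x. x * _"] cong: if_cong)

lemma psd_sqrt_Diag:
  assumes c: "c \<in> pos_vecs"
  shows "psd_sqrt (Diag c) = Diag (\<chi> i. sqrt (c $ i))"
proof -
  let ?S = "Diag (\<chi> i. sqrt (c $ i))"
  have cpos: "0 < c $ i" for i
    using c by (simp add: pos_vecs_def)
  have quad: "x \<bullet> (?S *v x) = (\<Sum>i\<in>UNIV. sqrt (c $ i) * (x $ i)\<^sup>2)" for x
    by (simp add: inner_vec_def Diag_mult_vec power2_eq_square mult_ac)
  have SS: "?S ** ?S = Diag c"
    using cpos by (simp add: vec_eq_iff Diag_mult_left) (simp add: Diag_nth less_imp_le)
  have "is_psd_sqrt (Diag c) ?S"
    unfolding is_psd_sqrt_def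
  proof (intro conjI allI)
    show "transpose ?S = ?S"
      by (simp add: vec_eq_iff transpose_def Diag_nth)
    show "0 \<le> x \<bullet> (?S *v x)" for x
      unfolding quad using cpos by (intro sum_nonneg) (simp add: less_imp_le)
  qed (rule SS)
  moreover have "R = ?S" if "is_psd_sqrt (Diag c) R" for R
  proof -
    have RR: "R ** R = Diag c" and Rpsd: "\<And>x. 0 \<le> x \<bullet> (R *v x)"
      and Rsym: "transpose R = R"
      using that by (auto simp: is_psd_sqrt_def)
    have "R ** Diag c = Diag c ** R"
      by (metis RR matrix_mul_assoc)
    then have "R $ i $ j * c $ j = c $ i * R $ i $ j" for i j
      by (metis Diag_mult_left Diag_mult_right)
    then have "R $ i $ j = 0 \<or> c $ i = c $ j" for i j
      by (metis mult.commute mult_cancel_left)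
    then have "R $ i $ j * sqrt (c $ j) = sqrt (c $ i) * R $ i $ j" for i j
      by (metis mult.commute mult_zero_left)
    then have comm: "R ** ?S = ?S ** R"
      by (simp add: vec_eq_iff Diag_mult_left Diag_mult_right)
    have zero: "(R + ?S) ** (R - ?S) = 0"
    proof -
      have "(R + ?S) ** (R - ?S) = R ** R - R ** ?S + (?S ** R - ?S ** ?S)"
        by (simp add: vec_eq_iff matrix_matrix_mult_def algebra_simps
              sum.distrib sum_subtractf)
      then show ?thesis
        by (simp add: RR SS comm)
    qed
    have "(R - ?S) *v x = 0" for x
    proof -
      let ?y = "(R - ?S) *v x"
      have "(R + ?S) *v ?y = 0"
        by (simp add: matrix_vector_mul_assoc zero)
      then have "?y \<bullet> (R *v ?y) + ?y \<bullet> (?S *v ?y) = 0"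
        by (metis inner_add_right inner_zero_right matrix_vector_mult_add_rdistrib)
      moreover have "0 \<le> ?y \<bullet> (R *v ?y)" by (rule Rpsd)
      ultimately have "?y \<bullet> (?S *v ?y) \<le> 0" by linarith
      then have le: "(\<Sum>i\<in>UNIV. sqrt (c $ i) * (?y $ i)\<^sup>2) \<le> 0"
        unfolding quad .
      have nn: "0 \<le> sqrt (c $ i) * (?y $ i)\<^sup>2" for i
        using cpos by (simp add: less_imp_le)
      have "(\<Sum>i\<in>UNIV. sqrt (c $ i) * (?y $ i)\<^sup>2) = 0"
        using le nn by (intro antisym sum_nonneg) auto
      then have "sqrt (c $ i) * (?y $ i)\<^sup>2 = 0" for i
        using nn by (subst (asm) sum_nonneg_eq_0_iff) auto
      then have "?y $ i = 0" for i
        using cpos [of i] by (metis mult_eq_0_iff power_eq_0_iff real_sqrt_eq_0_iff less_irrefl)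
      then show ?thesis by (simp only: vec_eq_iff zero_index) simp
    qed
    then show "R = ?S"
      by (metis eq_iff_diff_eq_0 matrix_eq matrix_vector_mult_0)
  qed
  ultimately show ?thesis
    unfolding psd_sqrt_def by (rule the_equality)
qed

end

theory Submission
  imports Defs
begin

text \<open>Write \<open>R\<^sub>i\<close> for the \<open>i\<close>-th entry of \<open>diag (C A D A\<^sup>T)\<close>, so that the trace in the
  objective is \<open>\<Sum>\<^sub>i R\<^sub>i\<close>. Replacing \<open>c\<^sub>i\<close> by \<open>c\<^sub>i / R\<^sub>i\<close> makes the trace equal to \<open>n\<close> and divides
  the determinant by \<open>\<Prod>\<^sub>i R\<^sub>i\<close>. Optimality therefore says that the arithmetic mean of the \<open>R\<^sub>i\<close>
  is at most their geometric mean, so all \<open>R\<^sub>i\<close> equal the mean of the trace. The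
  objective is invariant under exchanging \<open>(A, c, d)\<close> with \<open>(A\<^sup>T, d, c)\<close>, which gives the
  columns the same constant.\<close>

text \<open>This is the equality case of the AM-GM inequality. With \<open>m\<close> the mean, each
  \<open>x = R i / m\<close> satisfies \<open>ln x \<le> x - 1\<close>, with equality only at
  \<open>x = 1\<close>; the hypothesis leaves no room for a positive gap.\<close>

lemma eq_mean_if_mean_le_geometric_mean:
  fixes R :: "'n::finite \<Rightarrow> real"
  assumes pos: "\<And>i. 0 < R i"
    and le: "(\<Sum>i\<in>UNIV. R i) / real CARD('n) \<le> (\<Prod>i\<in>UNIV. R i) powr (1 / real CARD('n))"
  shows "R i = (\<Sum>i\<in>UNIV. R i) / real CARD('n)"
proof -
  define m where "m = (\<Sum>i\<in>UNIV. R i) / real CARD('n)"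
  have m: "0 < m"
    unfolding m_def using pos by (simp add: sum_pos)
  have nz: "R i \<noteq> 0" for i
    using pos [of i] by simp
  have "ln m \<le> ln ((\<Prod>i\<in>UNIV. R i) powr (1 / real CARD('n)))"
    by (rule ln_mono) (use m le in \<open>simp_all add: m_def\<close>)
  also have "\<dots> = (\<Sum>i\<in>UNIV. ln (R i)) / real CARD('n)"
    by (simp add: ln_powr ln_prod nz)
  finally have "real CARD('n) * ln m \<le> (\<Sum>i\<in>UNIV. ln (R i))"
    by (simp add: field_simps)
  moreover have "(\<Sum>i\<in>UNIV. ln (R i / m)) = (\<Sum>i\<in>UNIV. ln (R i)) - real CARD('n) * ln m"
    using m by (simp add: ln_div nz sum_subtractf)
  moreover have "(\<Sum>i\<in>UNIV. R i / m) = real CARD('n)"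
    unfolding sum_divide_distrib [symmetric] using m by (auto simp: m_def)
  \<comment> \<open>The ratios \<open>R i / m\<close> sum to \<open>CARD('n)\<close>, which cancels
    the sum of the ones; the logarithms that remain sum to a nonnegative number.\<close>
  ultimately have "(\<Sum>i\<in>UNIV. R i / m - 1 - ln (R i / m)) \<le> 0"
    by (simp add: sum_subtractf)
  moreover have nn: "0 \<le> R i / m - 1 - ln (R i / m)" for i
    using ln_le_minus_one [of "R i / m"] pos m by simp
  ultimately have "(\<Sum>i\<in>UNIV. R i / m - 1 - ln (R i / m)) = 0"
    by (intro antisym sum_nonneg) auto
  then have "R i / m - 1 - ln (R i / m) = 0"
    using nn by (subst (asm) sum_nonneg_eq_0_iff) auto
  then have "R i / m = 1"
    using pos [of i] m by (intro ln_eq_minus_one) auto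
  then show ?thesis
    using m by (simp add: m_def [symmetric])
qed

lemma scaled_nth:
  assumes "c \<in> pos_vecs" "d \<in> pos_vecs"
  shows "scaled A c d $ i $ j = sqrt (c $ i) * A $ i $ j * sqrt (d $ j)"
  by (simp add: scaled_def psd_sqrt_Diag assms Diag_mult_left Diag_mult_right)

lemma transpose_scaled:
  assumes "c \<in> pos_vecs" "d \<in> pos_vecs"
  shows "transpose (scaled A c d) = scaled (transpose A) d c"
  using assms by (simp add: vec_eq_iff scaled_nth transpose_def mult_ac)

lemma det_Diag: "det (Diag c) = (\<Prod>i\<in>UNIV. c $ i)"
  by (simp add: det_diagonal Diag_nth)

lemma diag_scaling_nth:
  "diag_of (Diag c ** A ** Diag d ** transpose A) $ i = (\<Sum>j\<in>UNIV. c $ i * (A $ i $ j)\<^sup>2 * d $ j)"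
proof -
  have "(Diag c ** A ** Diag d ** transpose A) $ i $ i
      = (\<Sum>j\<in>UNIV. (Diag c ** A ** Diag d) $ i $ j * A $ i $ j)"
    by (simp add: matrix_matrix_mult_def [of "Diag c ** A ** Diag d"] transpose_def)
  then show ?thesis
    by (simp add: diag_of_def Diag_mult_left Diag_mult_right power2_eq_square mult_ac)
qed

text \<open>The trace of a Gram matrix is the sum of the squared entries and its determinant is a
  squared determinant, so all square roots disappear.\<close>

lemma omega_cond_scaled:
  fixes A :: "real^'n^'n"
  assumes c: "c \<in> pos_vecs" and d: "d \<in> pos_vecs"
  shows "omega_cond (transpose (scaled A c d) ** scaled A c d)
    = ((\<Sum>i\<in>UNIV. diag_of (Diag c ** A ** Diag d ** transpose A) $ i) / real CARD('n))
      / ((\<Prod>i\<in>UNIV. c $ i) * (\<Prod>i\<in>UNIV. d $ i) * (det A)\<^sup>2) powr (1 / real CARD('n))"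
proof -
  have cd: "0 < c $ i" "0 < d $ i" for i
    using c d by (auto simp: pos_vecs_def)
  have "trace (transpose (scaled A c d) ** scaled A c d)
      = (\<Sum>j\<in>UNIV. \<Sum>i\<in>UNIV. (scaled A c d $ i $ j)\<^sup>2)"
    by (simp add: trace_def matrix_matrix_mult_def transpose_def power2_eq_square)
  also have "\<dots> = (\<Sum>i\<in>UNIV. \<Sum>j\<in>UNIV. c $ i * (A $ i $ j)\<^sup>2 * d $ j)"
    using cd by (subst sum.swap) (simp add: scaled_nth c d power_mult_distrib less_imp_le)
  finally have tr: "trace (transpose (scaled A c d) ** scaled A c d)
      = (\<Sum>i\<in>UNIV. diag_of (Diag c ** A ** Diag d ** transpose A) $ i)"
    by (simp add: diag_scaling_nth)
  have "det (transpose (scaled A c d) ** scaled A c d) = (det (scaled A c d))\<^sup>2"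
    by (simp add: det_mul power2_eq_square)
  also have "\<dots> = (\<Prod>i\<in>UNIV. (sqrt (c $ i))\<^sup>2) * (\<Prod>i\<in>UNIV. (sqrt (d $ i))\<^sup>2) * (det A)\<^sup>2"
    by (simp add: scaled_def psd_sqrt_Diag c d det_mul det_Diag power_mult_distrib
        prod_power_distrib)
  finally have "det (transpose (scaled A c d) ** scaled A c d)
      = (\<Prod>i\<in>UNIV. c $ i) * (\<Prod>i\<in>UNIV. d $ i) * (det A)\<^sup>2"
    using cd by (simp add: less_imp_le)
  with tr show ?thesis
    by (simp add: omega_cond_def)
qed

text \<open>Both sides are one double sum taken in two orders. This is what makes the row constant
  and the column constant coincide.\<close>

lemma sum_diag_scaling_transpose:
  "(\<Sum>i\<in>UNIV. diag_of (Diag d ** transpose A ** Diag c ** A) $ i)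
    = (\<Sum>i\<in>UNIV. diag_of (Diag c ** A ** Diag d ** transpose A) $ i)"
proof -
  have "(\<Sum>i\<in>UNIV. diag_of (Diag d ** transpose A ** Diag c ** A) $ i)
      = (\<Sum>j\<in>UNIV. \<Sum>i\<in>UNIV. c $ i * (A $ i $ j)\<^sup>2 * d $ j)"
    using diag_scaling_nth [of d "transpose A" c] by (simp add: transpose_def mult_ac)
  also have "\<dots> = (\<Sum>i\<in>UNIV. \<Sum>j\<in>UNIV. c $ i * (A $ i $ j)\<^sup>2 * d $ j)"
    by (rule sum.swap)
  finally show ?thesis
    by (simp add: diag_scaling_nth)
qed

lemma omega_cond_scaled_transpose:
  assumes "c \<in> pos_vecs" "d \<in> pos_vecs"
  shows "omega_cond (transpose (scaled (transpose A) d c) ** scaled (transpose A) d c)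
    = omega_cond (transpose (scaled A c d) ** scaled A c d)"
  using assms by (simp add: omega_cond_scaled sum_diag_scaling_transpose mult_ac)

text \<open>Only the left scaling varies in \<open>opt\<close>, with \<open>d\<close> fixed, so the
  lemma serves the rows directly and the columns through the transpose.\<close>

lemma diag_scaling_eq_mean:
  fixes A :: "real^'n^'n"
  assumes A: "invertible A" and c: "c \<in> pos_vecs" and d: "d \<in> pos_vecs"
    and opt: "\<And>b. b \<in> pos_vecs \<Longrightarrow> omega_cond (transpose (scaled A c d) ** scaled A c d)
      \<le> omega_cond (transpose (scaled A b d) ** scaled A b d)"
  defines "R \<equiv> diag_of (Diag c ** A ** Diag d ** transpose A)"
  shows "0 < R $ i" and "R $ i = (\<Sum>i\<in>UNIV. R $ i) / real CARD('n)"
proof -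
  have cd: "0 < c $ i" "0 < d $ i" for i
    using c d by (auto simp: pos_vecs_def)
  have detA: "det A \<noteq> 0"
    using A by (simp add: invertible_det_nz)
  have Rpos: "0 < R $ i" for i
  proof -
    \<comment> \<open>A zero row would make the determinant vanish.\<close>
    have "row i A \<noteq> 0"
      using detA det_zero_row(2) by (metis)
    then obtain j where "A $ i $ j \<noteq> 0"
      by (auto simp: vec_eq_iff row_def)
    then have "0 < (\<Sum>j\<in>UNIV. c $ i * (A $ i $ j)\<^sup>2 * d $ j)"
      using cd by (intro sum_pos2 [of _ j]) (auto simp: less_imp_le)
    then show ?thesis
      by (simp add: R_def diag_scaling_nth)
  qed
  then show "0 < R $ i" .
  define P where "P = (\<Prod>i\<in>UNIV. c $ i) * (\<Prod>i\<in>UNIV. d $ i) * (det A)\<^sup>2"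
  have P: "0 < P"
    unfolding P_def using cd detA by (simp add: prod_pos)
  define b where "b = (\<chi> i. c $ i / R $ i)"
  have b: "b \<in> pos_vecs"
    using cd Rpos by (simp add: b_def pos_vecs_def)
  have "diag_of (Diag b ** A ** Diag d ** transpose A) $ i
      = diag_of (Diag c ** A ** Diag d ** transpose A) $ i / R $ i" for i
    unfolding diag_scaling_nth by (simp add: b_def sum_divide_distrib)
  then have "diag_of (Diag b ** A ** Diag d ** transpose A) $ i = 1" for i
    using Rpos [of i] by (simp add: R_def [symmetric])
  moreover have "(\<Prod>i\<in>UNIV. b $ i) * (\<Prod>i\<in>UNIV. d $ i) * (det A)\<^sup>2 = P / (\<Prod>i\<in>UNIV. R $ i)"
    by (simp add: b_def P_def prod_dividef)
  ultimately have "omega_cond (transpose (scaled A b d) ** scaled A b d)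
      = (\<Prod>i\<in>UNIV. R $ i) powr (1 / real CARD('n)) / P powr (1 / real CARD('n))"
    using P Rpos by (simp add: omega_cond_scaled b d powr_divide prod_nonneg less_imp_le)
  moreover have "omega_cond (transpose (scaled A c d) ** scaled A c d)
      = ((\<Sum>i\<in>UNIV. R $ i) / real CARD('n)) / P powr (1 / real CARD('n))"
    by (simp add: omega_cond_scaled c d P_def R_def)
  moreover have "0 < P powr (1 / real CARD('n))"
    using P by simp
  \<comment> \<open>Both objective values carry the same positive denominator, which
    cancels.\<close>
  ultimately have "(\<Sum>i\<in>UNIV. R $ i) / real CARD('n) \<le> (\<Prod>i\<in>UNIV. R $ i) powr (1 / real CARD('n))"
    using opt [OF b] by (metis divide_le_cancel less_asym)
  with Rpos show "R $ i = (\<Sum>i\<in>UNIV. R $ i) / real CARD('n)"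
    by (rule eq_mean_if_mean_le_geometric_mean)
qed

text \<open>Squaring the entries of row \<open>i\<close> gives exactly the summands in
  \<open>diag_scaling_nth\<close>.\<close>

lemma norm_row_scaled:
  assumes "c \<in> pos_vecs" "d \<in> pos_vecs"
  shows "norm (row i (scaled A c d))
    = sqrt (diag_of (Diag c ** A ** Diag d ** transpose A) $ i)"
proof -
  have "0 < c $ i" "0 < d $ i" for i
    using assms by (auto simp: pos_vecs_def)
  then show ?thesis
    by (simp add: norm_vec_def L2_set_def row_def diag_scaling_nth scaled_nth assms
        power_mult_distrib less_imp_le)
qed

theorem theorem3p6:
  fixes A :: "real^'n^'n" and c' d' :: "real^'n"
  assumes "invertible A"
    and "is_arg_min (\<lambda>(c, d). omega_cond (transpose (scaled A c d) ** scaled A c d))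
           (\<lambda>(c, d). c \<in> pos_vecs \<and> d \<in> pos_vecs) (c', d')"
  shows "(\<exists>\<alpha>>0. stack_vec (diag_of (Diag c' ** A ** Diag d' ** transpose A))
                         (diag_of (Diag d' ** transpose A ** Diag c' ** A))
                 = \<alpha> *\<^sub>R (vec 1 :: real^('n + 'n)))
       \<and> (\<exists>\<kappa>. (\<forall>i. norm (row i (scaled A c' d')) = \<kappa>)
             \<and> (\<forall>j. norm (column j (scaled A c' d')) = \<kappa>))"
proof -
  have c: "c' \<in> pos_vecs" and d: "d' \<in> pos_vecs"
    and opt: "\<And>c d. c \<in> pos_vecs \<Longrightarrow> d \<in> pos_vecs \<Longrightarrow>
      omega_cond (transpose (scaled A c' d') ** scaled A c' d')
        \<le> omega_cond (transpose (scaled A c d) ** scaled A c d)"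
    using assms(2) by (auto simp: is_arg_min_def not_less)
  define R where "R = diag_of (Diag c' ** A ** Diag d' ** transpose A)"
  define Q where "Q = diag_of (Diag d' ** transpose A ** Diag c' ** A)"
  define m where "m = (\<Sum>i\<in>UNIV. R $ i) / real CARD('n)"
  have R: "0 < R $ i" "R $ i = m" for i
    unfolding m_def R_def
    using diag_scaling_eq_mean [OF assms(1) c d opt [OF _ d]] by blast+
  \<comment> \<open>The roles are exchanged: \<open>c'\<close> stays fixed while \<open>d'\<close>
    varies, and \<open>omega_cond_scaled_transpose\<close> carries optimality over to
    \<open>transpose A\<close>.\<close>
  have "Q $ i = (\<Sum>i\<in>UNIV. Q $ i) / real CARD('n)" for i
    using diag_scaling_eq_mean(2) [OF transpose_invertible [OF assms(1)] d c, of i]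
      opt [OF c] omega_cond_scaled_transpose [OF c]
    by (simp add: Q_def d)
  then have Q: "Q $ i = m" for i
    by (simp add: m_def R_def Q_def sum_diag_scaling_transpose)
  have "stack_vec R Q = m *\<^sub>R vec 1"
    by (simp add: vec_eq_iff stack_vec_def R(2) Q split: sum.split)
  moreover have "0 < m"
    using R by metis
  moreover have "norm (row i (scaled A c' d')) = sqrt m" for i
    using R(2) by (simp add: norm_row_scaled c d R_def)
  \<comment> \<open>Columns are rows of the transpose, which is itself a scaling of
    \<open>transpose A\<close>.\<close>
  moreover have "norm (column j (scaled A c' d')) = sqrt m" for j
    using Q norm_row_scaled [OF d c, of j "transpose A"]
    by (simp add: transpose_scaled [OF c d, symmetric] row_transpose Q_def)
  ultimately show ?thesis
    unfolding R_def Q_def by blast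
qed

end
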